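(* For every $\lambda\in E$, one has $P(\lambda)=0$ if and only if $\lambda\in\Sigma$.
   Context: Sampling setting. $(\Omega,\theta,\mu)$ is a probability space with an ergodic, $\mu$-preserving map $\theta$; $\omega\sim\mu$ and $\omega_m=\theta^m(\omega)$; $\mathbb E,\mathbb P$ are taken with respect to $\mu$. Let $N\ge 1$ and $E\subseteq\mathbb C$. For every $\omega\in\Omega$ and $\lambda\in E$ there is a matrix $C_{\lambda,\omega}\in\mathbb C^{N\times N}$ (measurable in $\omega$); these matrices are uniformly bounded in $(\lambda,\omega)$ and are analytic functions of $\lambda$ on $E$. Put $C_\lambda=\mathbb E[C_{\lambda,\omega}]$, $\hat C_\lambda=\frac1M\sum_{m=1}^M C_{\lambda,\omega_m}$, $\tilde C_\lambda=\hat C_\lambda-C_\lambda$, and $\Sigma=\{\lambda\in E:\ker C_\lambda\ne\{0\}\}$. Standing assumption (central limit theorem). For every $\lambda\in E$ and every linear $h:\mathbb C^{N\times N}\to\mathbb C$, with $S_M(\omega,h)=\frac1M\sum_{m=1}^M h[C_{\lambda,\omega_m}]-h[C_\lambda]$: the limit $\sigma^2_{h,\lambda}=\lim_{M\to\infty}M\,\mathbb E[|S_M(\omega,h)|^2]$ exists and is finite, and the real and imaginary parts of $\sqrt M S_M(\cdot,h)$ jointly converge in distribution to a centred normal distribution on $\mathbb R^2$ whose covariance matrix has trace $\sigma^2_{h,\lambda}$. $Q\succ0$ (resp. $Q\succeq 0$) means $Q$ is Hermitian positive definite (resp. semi-definite), and $\|\mathbf v\|_Q^2=\mathbf v^*Q\mathbf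 v$. The variance operator is $\mathcal V_\lambda[Q]=\lim_{M\to\infty}M\,\mathbb E[\tilde C_\lambda^*Q\tilde C_\lambda]$ (equivalently $\mathbf v^*\mathcal V_\lambda[Q]\mathbf v=\lim_{M\to\infty} M\,\mathbb E\|\tilde C_\lambda\mathbf v\|_Q^2$ for all $\mathbf v\in\mathbb C^N$). Define $P:E\to[0,\infty]$ by $$P(\lambda)=\sup_{Q\succ0}P(\lambda,Q),\qquad P(\lambda,Q)=\inf_{\mathbf v\ne0}\frac{\|C_\lambda\mathbf v\|_Q^2}{\mathbf v^*\mathcal V_\lambda[Q]\mathbf v},$$ where a quotient with zero denominator is $+\infty$ if the numerator is positive and $0$ if the numerator is $0$. *)

theory Defs
  imports "HOL-Probability.Probability"
begin

definition measure_preserving_map :: "'w measure \<Rightarrow> ('w \<Rightarrow> 'w) \<Rightarrow> bool" where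
  "measure_preserving_map \<mu> \<theta> \<longleftrightarrow> \<theta> \<in> measurable \<mu> \<mu> \<and> distr \<mu> \<mu> \<theta> = \<mu>"

definition ergodic_map :: "'w measure \<Rightarrow> ('w \<Rightarrow> 'w) \<Rightarrow> bool" where
  "ergodic_map \<mu> \<theta> \<longleftrightarrow> measure_preserving_map \<mu> \<theta> \<and>
     (\<forall>A\<in>sets \<mu>. \<theta> -` A \<inter> space \<mu> = A \<longrightarrow> measure \<mu> A = 0 \<or> measure \<mu> A = 1)"

definition adjoint_matrix :: "complex^'n^'m \<Rightarrow> complex^'m^'n" where
  "adjoint_matrix A = (\<chi> i j. cnj (A $ j $ i))"

definition qform :: "complex^'n^'n \<Rightarrow> complex^'n \<Rightarrow> complex" where
  "qform Q v = (\<Sum>i\<in>UNIV. cnj (v $ i) * (Q *v v) $ i)"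

definition hermitian_pos_def :: "complex^'n^'n \<Rightarrow> bool" where
  "hermitian_pos_def Q \<longleftrightarrow> adjoint_matrix Q = Q \<and> (\<forall>v. v \<noteq> 0 \<longrightarrow> Re (qform Q v) > 0)"

text \<open>The type \<^typ>\<open>complex^'n^'n\<close> only carries a real vector space structure; the complex
  one is given by entrywise multiplication.\<close>

definition complex_linear_functional :: "(complex^'n^'n \<Rightarrow> complex) \<Rightarrow> bool" where
  "complex_linear_functional h \<longleftrightarrow> Vector_Spaces.linear (\<lambda>c. map_matrix ((*) c)) (*) h"

text \<open>Normal distributions are specified by their characteristic functions, so that a
  singular covariance matrix (in particular a point mass) is allowed.\<close>

definition centred_normal :: "real^2^2 \<Rightarrow> (real^2) measure \<Rightarrow> bool" where
  "centred_normal K \<nu> \<longleftrightarrow> transpose K = K \<and> prob_space \<nu> \<and> sets \<nu> = sets borel \<and>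
     (\<forall>t. (CLINT x|\<nu>. iexp (t \<bullet> x)) = of_real (exp (- (t \<bullet> (K *v t)) / 2)))"

definition converges_weakly :: "(nat \<Rightarrow> 'a::topological_space measure) \<Rightarrow> 'a measure \<Rightarrow> bool" where
  "converges_weakly \<nu>s \<nu> \<longleftrightarrow> (\<forall>f::'a \<Rightarrow> real. continuous_on UNIV f \<longrightarrow> bounded (range f) \<longrightarrow>
     (\<lambda>M. LINT x|\<nu>s M. f x) \<longlonglongrightarrow> (LINT x|\<nu>. f x))"

definition mean_mat :: "'w measure \<Rightarrow> (complex \<Rightarrow> 'w \<Rightarrow> complex^'n^'n) \<Rightarrow> complex \<Rightarrow> complex^'n^'n" where
  "mean_mat \<mu> C l = (LINT \<omega>|\<mu>. C l \<omega>)"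

definition emp_mat ::
  "('w \<Rightarrow> 'w) \<Rightarrow> (complex \<Rightarrow> 'w \<Rightarrow> complex^'n^'n) \<Rightarrow> complex \<Rightarrow> nat \<Rightarrow> 'w \<Rightarrow> complex^'n^'n" where
  "emp_mat \<theta> C l M \<omega> = (1 / real M) *\<^sub>R (\<Sum>m=1..M. C l ((\<theta> ^^ m) \<omega>))"

definition err_mat ::
  "'w measure \<Rightarrow> ('w \<Rightarrow> 'w) \<Rightarrow> (complex \<Rightarrow> 'w \<Rightarrow> complex^'n^'n) \<Rightarrow> complex \<Rightarrow> nat \<Rightarrow> 'w \<Rightarrow> complex^'n^'n" where
  "err_mat \<mu> \<theta> C l M \<omega> = emp_mat \<theta> C l M \<omega> - mean_mat \<mu> C l"

definition sing_set ::
  "'w measure \<Rightarrow> (complex \<Rightarrow> 'w \<Rightarrow> complex^'n^'n) \<Rightarrow> complex set \<Rightarrow> complex set" where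
  "sing_set \<mu> C E = {l \<in> E. {v. mean_mat \<mu> C l *v v = 0} \<noteq> {0}}"

definition clt_err ::
  "'w measure \<Rightarrow> ('w \<Rightarrow> 'w) \<Rightarrow> (complex \<Rightarrow> 'w \<Rightarrow> complex^'n^'n) \<Rightarrow> complex \<Rightarrow>
    (complex^'n^'n \<Rightarrow> complex) \<Rightarrow> nat \<Rightarrow> 'w \<Rightarrow> complex" where
  "clt_err \<mu> \<theta> C l h M \<omega> =
     (1 / of_nat M) * (\<Sum>m=1..M. h (C l ((\<theta> ^^ m) \<omega>))) - h (mean_mat \<mu> C l)"

definition satisfies_clt ::
  "'w measure \<Rightarrow> ('w \<Rightarrow> 'w) \<Rightarrow> (complex \<Rightarrow> 'w \<Rightarrow> complex^'n^'n) \<Rightarrow> complex \<Rightarrow>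
    (complex^'n^'n \<Rightarrow> complex) \<Rightarrow> bool" where
  "satisfies_clt \<mu> \<theta> C l h \<longleftrightarrow> (\<exists>(\<sigma>2::real) K \<nu>.
     (\<lambda>M. real M * (LINT \<omega>|\<mu>. (cmod (clt_err \<mu> \<theta> C l h M \<omega>))\<^sup>2)) \<longlonglongrightarrow> \<sigma>2 \<and>
     centred_normal K \<nu> \<and> trace K = \<sigma>2 \<and>
     converges_weakly
       (\<lambda>M. distr \<mu> borel (\<lambda>\<omega>. sqrt (real M) *\<^sub>R
          (vector [Re (clt_err \<mu> \<theta> C l h M \<omega>), Im (clt_err \<mu> \<theta> C l h M \<omega>)] :: real^2)))
       \<nu>)"

definition variance_op ::
  "'w measure \<Rightarrow> ('w \<Rightarrow> 'w) \<Rightarrow> (complex \<Rightarrow> 'w \<Rightarrow> complex^'n^'n) \<Rightarrow> complex \<Rightarrow> complex^'n^'n \<Rightarrow> complex^'n^'n" where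
  "variance_op \<mu> \<theta> C l Q = lim (\<lambda>M. real M *\<^sub>R
     (LINT \<omega>|\<mu>. adjoint_matrix (err_mat \<mu> \<theta> C l M \<omega>) ** Q ** err_mat \<mu> \<theta> C l M \<omega>))"

text \<open>Division on \<^typ>\<open>ennreal\<close> satisfies \<open>a / 0 = \<infinity>\<close> for \<open>a > 0\<close> and \<open>0 / 0 = 0\<close>, which is the
  convention wanted for the quotients. Numerator and denominator are real and nonnegative
  when \<open>Q\<close> is positive definite, so that neither \<^term>\<open>Re\<close> nor \<^term>\<open>ennreal\<close> loses
  information.\<close>

definition P_quot ::
  "'w measure \<Rightarrow> ('w \<Rightarrow> 'w) \<Rightarrow> (complex \<Rightarrow> 'w \<Rightarrow> complex^'n^'n) \<Rightarrow> complex \<Rightarrow> complex^'n^'n \<Rightarrow> ennreal" where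
  "P_quot \<mu> \<theta> C l Q = (INF v\<in>{v. v \<noteq> 0}.
     ennreal (Re (qform Q (mean_mat \<mu> C l *v v))) / ennreal (Re (qform (variance_op \<mu> \<theta> C l Q) v)))"

definition P_fun ::
  "'w measure \<Rightarrow> ('w \<Rightarrow> 'w) \<Rightarrow> (complex \<Rightarrow> 'w \<Rightarrow> complex^'n^'n) \<Rightarrow> complex \<Rightarrow> ennreal" where
  "P_fun \<mu> \<theta> C l = (SUP Q\<in>{Q. hermitian_pos_def Q}. P_quot \<mu> \<theta> C l Q)"

end

theory Submission
  imports Defs
begin

(* Whatever matrix V_l[Q] is, its quadratic form is bounded by a multiple of |v|^2. Hence, if C_l
   is invertible, Q = 1 already gives a quotient bounded away from 0, as |C_l v| >= c |v| with
   c > 0. If C_l v = 0 with v nonzero, then v makes the quotient vanish for every Q. *)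

text \<open>The real inner product on \<open>complex^'n\<close> is the real part of the Hermitian
  one; this opens the way to Cauchy-Schwarz.\<close>

lemma Re_qform: "Re (qform Q v) = v \<bullet> (Q *v v)"
  by (simp add: qform_def inner_vec_def inner_complex_def)

lemma linear_matrix_vector_mult: "linear ((*v) (A::complex^'n^'m))"
  by (intro linearI)
    (simp_all add: vec_eq_iff matrix_vector_mult_def algebra_simps sum.distrib scaleR_sum_right)

lemma hermitian_pos_def_mat_1: "hermitian_pos_def (mat 1 :: complex^'n^'n)"
proof -
  have "adjoint_matrix (mat 1 :: complex^'n^'n) = mat 1"
    by (simp add: adjoint_matrix_def mat_def vec_eq_iff)
  then show ?thesis
    by (simp add: hermitian_pos_def_def Re_qform)
qed

text \<open>Cauchy-Schwarz combined with the operator bound of \<open>Q\<close>. A strictly positive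
  \<open>K\<close>, even for \<open>Q = 0\<close>, allows dividing by it later.\<close>

lemma Re_qform_bounded: "\<exists>K>0. \<forall>v. Re (qform Q v) \<le> K * (norm v)\<^sup>2"
proof -
  obtain K where K: "K > 0" "\<And>v. norm (Q *v v) \<le> K * norm v"
    using linear_bounded_pos[OF linear_matrix_vector_mult[of Q]] by blast
  have "Re (qform Q v) \<le> K * (norm v)\<^sup>2" for v
  proof -
    have "Re (qform Q v) \<le> norm v * norm (Q *v v)"
      by (simp add: Re_qform norm_cauchy_schwarz)
    also have "\<dots> \<le> norm v * (K * norm v)"
      by (intro mult_left_mono K) simp
    finally show ?thesis
      by (simp add: power2_eq_square algebra_simps)
  qed
  with K(1) show ?thesis by blast
qed

text \<open>A trivial kernel means injectivity, which in finite dimension gives a lower bound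
  uniform in \<open>v\<close>.\<close>

lemma matrix_vector_mult_bounded_below:
  fixes A :: "complex^'n^'n"
  assumes "{v. A *v v = 0} = {0}"
  shows "\<exists>c>0. \<forall>v. c * norm v \<le> norm (A *v v)"
proof -
  have "inj ((*v) A)"
    using assms by (auto simp: linear_injective_0[OF linear_matrix_vector_mult])
  then obtain c where "c > 0" "\<And>v. c * norm v \<le> norm (A *v v)"
    using linear_inj_bounded_below_pos[OF linear_matrix_vector_mult] by blast
  then show ?thesis by blast
qed

text \<open>Meant for a single quotient in \<open>P_quot\<close>, with \<open>x\<close> the squared
  norm of \<open>v\<close>. The sign of \<open>b\<close> is left open, as \<open>ennreal\<close>
  truncates negative numbers to 0.\<close>

lemma ennreal_divide_ge_quotient:
  assumes "c * x \<le> a" "b \<le> K * x" "0 < x" "0 < K" "0 < c"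
  shows "ennreal (c / K) \<le> ennreal a / ennreal b"
proof (cases "b > 0")
  case True
  have "0 < a"
    using assms by (meson less_le_trans mult_pos_pos)
  have "c / K = (c * x) / (K * x)"
    using assms by simp
  also have "\<dots> \<le> a / b"
    using assms True \<open>0 < a\<close> by (intro frac_le) auto
  finally show ?thesis
    using True \<open>0 < a\<close> by (simp add: divide_ennreal ennreal_leI)
next
  \<comment> \<open>Here \<open>ennreal b = 0\<close> while \<open>a > 0\<close>, so the quotient is
    infinite.\<close>
  case False
  have "0 < a"
    using assms by (meson less_le_trans mult_pos_pos)
  with False show ?thesis
    by (simp add: ennreal_neg divide_ennreal_def ennreal_mult_top)
qed

lemma P_fun_eq_0:
  assumes "v \<noteq> 0" "mean_mat \<mu> C l *v v = 0"
  shows "P_fun \<mu> \<theta> C l = 0"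
proof -
  \<comment> \<open>The quotient at \<open>v\<close> has numerator 0, and 0 divided by anything is 0
    in \<open>ennreal\<close>, including 0 / 0.\<close>
  have "P_quot \<mu> \<theta> C l Q \<le> 0" for Q
    unfolding P_quot_def using assms by (intro INF_lower2[of v]) (auto simp: Re_qform)
  then show ?thesis
    by (auto simp: P_fun_def SUP_eq_iff bot_ennreal intro!: antisym SUP_least)
qed

lemma P_fun_pos:
  assumes "{v. mean_mat \<mu> C l *v v = 0} = {0}"
  shows "P_fun \<mu> \<theta> C l > 0"
proof -
  obtain c where c: "c > 0" "\<And>v. c * norm v \<le> norm (mean_mat \<mu> C l *v v)"
    using matrix_vector_mult_bounded_below[OF assms] by blast
  obtain K where K: "K > 0"
    "\<And>v. Re (qform (variance_op \<mu> \<theta> C l (mat 1)) v) \<le> K * (norm v)\<^sup>2"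
    using Re_qform_bounded by blast
  \<comment> \<open>For \<open>Q = mat 1\<close> the numerator is a squared norm, so the lower bound
    gets squared.\<close>
  have num: "c\<^sup>2 * (norm v)\<^sup>2 \<le> Re (qform (mat 1) (mean_mat \<mu> C l *v v))" for v
    using power_mono[OF c(2)[of v], of 2] c(1)
    by (simp add: Re_qform power_mult_distrib power2_norm_eq_inner)
  \<comment> \<open>This bound does not depend on \<open>v\<close>, so positivity survives the
    infimum.\<close>
  have "0 < ennreal (c\<^sup>2 / K)"
    using c(1) K(1) by simp
  also have "\<dots> \<le> P_quot \<mu> \<theta> C l (mat 1)"
    unfolding P_quot_def using K c(1)
    by (intro INF_greatest ennreal_divide_ge_quotient[OF num]) auto
  also have "\<dots> \<le> P_fun \<mu> \<theta> C l"
    unfolding P_fun_def by (intro SUP_upper) (simp add: hermitian_pos_def_mat_1)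
  finally show ?thesis .
qed

theorem proposition2p1:
  fixes \<mu> :: "'w measure" and \<theta> :: "'w \<Rightarrow> 'w"
    and C :: "complex \<Rightarrow> 'w \<Rightarrow> complex^'n^'n" and E :: "complex set"
  assumes "prob_space \<mu>" and "ergodic_map \<mu> \<theta>"
    and "\<And>l. l \<in> E \<Longrightarrow> C l \<in> borel_measurable \<mu>"
    and "\<exists>B. \<forall>l\<in>E. \<forall>\<omega>\<in>space \<mu>. norm (C l \<omega>) \<le> B"
    and "\<And>\<omega> i j. \<omega> \<in> space \<mu> \<Longrightarrow> (\<lambda>l. C l \<omega> $ i $ j) analytic_on E"
    and "\<And>l h. l \<in> E \<Longrightarrow> complex_linear_functional h \<Longrightarrow> satisfies_clt \<mu> \<theta> C l h"
  shows "\<forall>l\<in>E. P_fun \<mu> \<theta> C l = 0 \<longleftrightarrow> l \<in> sing_set \<mu> C E"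
proof
  fix l assume l: "l \<in> E"
  show "P_fun \<mu> \<theta> C l = 0 \<longleftrightarrow> l \<in> sing_set \<mu> C E"
  proof
    assume "P_fun \<mu> \<theta> C l = 0"
    with l show "l \<in> sing_set \<mu> C E"
      using P_fun_pos[of \<mu> C l \<theta>] by (auto simp: sing_set_def)
  next
    assume "l \<in> sing_set \<mu> C E"
    then have "{v. mean_mat \<mu> C l *v v = 0} \<noteq> {0}"
      by (simp add: sing_set_def)
    \<comment> \<open>Since 0 lies in the kernel, a kernel other than {0} must contain a nonzero
      vector.\<close>
    moreover have "mean_mat \<mu> C l *v 0 = 0"
      by simp
    ultimately obtain v where "v \<noteq> 0" "mean_mat \<mu> C l *v v = 0"
      by blast
    then show "P_fun \<mu> \<theta> C l = 0"
      by (rule P_fun_eq_0)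
  qed
qed

end
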